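(* Let $(\mathcal{X},\wp)$ be a partial metric space, let $\mathcal{D}$ be a non-empty set, and for each $n\in\mathbb{N}$ let $f_n:\mathcal{D}\to\mathcal{X}$ be a function. If the sequence $\{f_n\}_{n\in\mathbb{N}}$ is uniformly Cauchy on $\mathcal{D}$ and has a subsequence $\{f_{n_i}\}_{i\in\mathbb{N}}$ (with $n_1<n_2<\cdots$) converging uniformly on $\mathcal{D}$ to a function $f:\mathcal{D}\to\mathcal{X}$, then $\{f_n\}_{n\in\mathbb{N}}$ is uniformly convergent to $f$ on $\mathcal{D}$.
   Context: A partial metric on a non-empty set $\mathcal{X}$ is a map $\wp:\mathcal{X}\times\mathcal{X}\to\mathbb{R}$ such that for all $x,y,z\in\mathcal{X}$: (1) $x=y$ if and only if $\wp(x,x)=\wp(x,y)=\wp(y,y)$; (2) $0\le \wp(x,x)\le\wp(x,y)$; (3) $\wp(x,y)=\wp(y,x)$; (4) $\wp(x,y)\le\wp(x,z)+\wp(z,y)-\wp(z,z)$. The pair $(\mathcal{X},\wp)$ is called a partial metric space. A sequence of functions $f_n:\mathcal{D}\to\mathcal{X}$ is uniformly convergent to $f:\mathcal{D}\to\mathcal{X}$ on $\mathcal{D}$ if for each $\epsilon>0$ there exists $k=k(\epsilon)\in\mathbb{N}$ such that for all $n\ge k$ and all $x\in\mathcal{D}$, $|\wp(f_n(x),f(x))-\wp(f(x),f(x))|<\epsilon$ and $|\wp(f_n(x),f_n(x))-\wp(f(x),f(x))|<\epsilon$. The sequence $\{f_n\}$ is uniformly Cauchy on $\mathcal{D}$ if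 for each $\epsilon>0$ there exists $N=N(\epsilon)\in\mathbb{N}$ such that $\sup_{x\in\mathcal{D}}|\wp(f_m(x),f_n(x))-\wp(f_j(x),f_k(x))|<\epsilon$ for all $m\ge j\ge N$ and $n\ge k\ge N$ (the supremum being taken in $[0,\infty]$). *)

theory Defs
  imports "HOL-Analysis.Analysis"
begin

locale partial_metric_space =
  fixes X :: "'a set" and p :: "'a \<Rightarrow> 'a \<Rightarrow> real"
  assumes nonempty: "X \<noteq> {}"
    and eq_iff: "\<And>x y. x \<in> X \<Longrightarrow> y \<in> X \<Longrightarrow> x = y \<longleftrightarrow> (p x x = p x y \<and> p x y = p y y)"
    and self_nonneg: "\<And>x. x \<in> X \<Longrightarrow> 0 \<le> p x x"
    and self_le: "\<And>x y. x \<in> X \<Longrightarrow> y \<in> X \<Longrightarrow> p x x \<le> p x y"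
    and commute: "\<And>x y. x \<in> X \<Longrightarrow> y \<in> X \<Longrightarrow> p x y = p y x"
    and triangle: "\<And>x y z. x \<in> X \<Longrightarrow> y \<in> X \<Longrightarrow> z \<in> X \<Longrightarrow> p x y \<le> p x z + p z y - p z z"

definition pm_uniformly_convergent ::
    "('a \<Rightarrow> 'a \<Rightarrow> real) \<Rightarrow> 'b set \<Rightarrow> (nat \<Rightarrow> 'b \<Rightarrow> 'a) \<Rightarrow> ('b \<Rightarrow> 'a) \<Rightarrow> bool" where
  "pm_uniformly_convergent p D f g \<longleftrightarrow>
    (\<forall>\<epsilon>>0. \<exists>k. \<forall>n\<ge>k. \<forall>x\<in>D.
       \<bar>p (f n x) (g x) - p (g x) (g x)\<bar> < \<epsilon> \<and>
       \<bar>p (f n x) (f n x) - p (g x) (g x)\<bar> < \<epsilon>)"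

text \<open>The supremum is taken in \<^typ>\<open>ennreal\<close>, so an unbounded family has supremum \<open>\<infinity>\<close>
  (in \<^typ>\<open>real\<close> its value would be unspecified).\<close>

definition pm_uniformly_Cauchy ::
    "('a \<Rightarrow> 'a \<Rightarrow> real) \<Rightarrow> 'b set \<Rightarrow> (nat \<Rightarrow> 'b \<Rightarrow> 'a) \<Rightarrow> bool" where
  "pm_uniformly_Cauchy p D f \<longleftrightarrow>
    (\<forall>\<epsilon>::real. \<epsilon> > 0 \<longrightarrow> (\<exists>N. \<forall>m n j k. m \<ge> j \<and> j \<ge> N \<and> n \<ge> k \<and> k \<ge> N \<longrightarrow>
       (SUP x\<in>D. ennreal \<bar>p (f m x) (f n x) - p (f j x) (f k x)\<bar>) < ennreal \<epsilon>))"

end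

theory Submission
  imports Defs
begin

text \<open>Compare \<open>f n x\<close> with \<open>g x\<close> through one far-out subsequence
  term \<open>f q x\<close>, where \<open>q\<close> does not depend on \<open>x\<close>.
  Self-distances differ by at most the Cauchy error plus the subsequence error. For the mixed
  distance, the partial-metric triangle inequality subtracts exactly
  \<open>p (f q x) (f q x)\<close>, so the excess of \<open>p (f n x) (g x)\<close> over
  \<open>p (g x) (g x)\<close> is bounded by the same two kinds of error.
  \<open>pm_uniformly_CauchyD\<close> turns the supremum condition into pointwise bounds free of
  order constraints on the indices.\<close>

lemma pm_uniformly_CauchyD:
  assumes "pm_uniformly_Cauchy p D f" and "\<epsilon> > 0"
  obtains N where "\<And>m n m' n' x. \<lbrakk>m \<ge> N; n \<ge> N; m' \<ge> N; n' \<ge> N; x \<in> D\<rbrakk>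
    \<Longrightarrow> \<bar>p (f m x) (f n x) - p (f m' x) (f n' x)\<bar> < \<epsilon>"
proof -
  obtain N where N: "\<And>m n j k. m \<ge> j \<and> j \<ge> N \<and> n \<ge> k \<and> k \<ge> N \<Longrightarrow>
      (SUP x\<in>D. ennreal \<bar>p (f m x) (f n x) - p (f j x) (f k x)\<bar>) < ennreal (\<epsilon> / 2)"
    using assms unfolding pm_uniformly_Cauchy_def by (meson half_gt_zero)
  \<comment> \<open>The definition compares only \<open>m \<ge> j\<close>, \<open>n \<ge> k\<close>; going through the index pair \<open>(N, N)\<close>
    removes the order constraint.\<close>
  have base: "\<bar>p (f m x) (f n x) - p (f N x) (f N x)\<bar> < \<epsilon> / 2"
    if "m \<ge> N" "n \<ge> N" "x \<in> D" for m n x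
  proof -
    have "ennreal \<bar>p (f m x) (f n x) - p (f N x) (f N x)\<bar>
        \<le> (SUP x\<in>D. ennreal \<bar>p (f m x) (f n x) - p (f N x) (f N x)\<bar>)"
      using that by (intro SUP_upper)
    also have "\<dots> < ennreal (\<epsilon> / 2)"
      using that by (intro N) auto
    finally show ?thesis
      by (simp add: ennreal_less_iff)
  qed
  show thesis
  proof (rule that)
    fix m n m' n' x
    assume "m \<ge> N" "n \<ge> N" "m' \<ge> N" "n' \<ge> N" "x \<in> D"
    then show "\<bar>p (f m x) (f n x) - p (f m' x) (f n' x)\<bar> < \<epsilon>"
      using base[of m n x] base[of m' n' x] by linarith
  qed
qed

theorem theorem3p5:
  fixes X :: "'a set" and p :: "'a \<Rightarrow> 'a \<Rightarrow> real" and D :: "'b set"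
    and f :: "nat \<Rightarrow> 'b \<Rightarrow> 'a" and g :: "'b \<Rightarrow> 'a" and r :: "nat \<Rightarrow> nat"
  assumes "partial_metric_space X p"
    and "D \<noteq> {}"
    and "\<And>n. f n \<in> D \<rightarrow> X"
    and "pm_uniformly_Cauchy p D f"
    and "strict_mono r"
    and "g \<in> D \<rightarrow> X"
    and "pm_uniformly_convergent p D (\<lambda>i. f (r i)) g"
  shows "pm_uniformly_convergent p D f g"
  unfolding pm_uniformly_convergent_def
proof (intro allI impI)
  interpret partial_metric_space X p by fact
  fix \<epsilon> :: real
  assume "\<epsilon> > 0"
  then have e2: "\<epsilon> / 2 > 0" by simp
  obtain N where N: "\<And>m n m' n' x. \<lbrakk>m \<ge> N; n \<ge> N; m' \<ge> N; n' \<ge> N; x \<in> D\<rbrakk>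
      \<Longrightarrow> \<bar>p (f m x) (f n x) - p (f m' x) (f n' x)\<bar> < \<epsilon> / 2"
    using pm_uniformly_CauchyD[OF assms(4) e2] by blast
  obtain K where K: "\<And>i x. \<lbrakk>i \<ge> K; x \<in> D\<rbrakk>
      \<Longrightarrow> \<bar>p (f (r i) x) (g x) - p (g x) (g x)\<bar> < \<epsilon> / 2
        \<and> \<bar>p (f (r i) x) (f (r i) x) - p (g x) (g x)\<bar> < \<epsilon> / 2"
    using assms(7) e2 unfolding pm_uniformly_convergent_def by meson
  \<comment> \<open>The position \<open>max N K\<close> is at least \<open>K\<close>, so the
    convergence bounds apply; since \<open>r i \<ge> i\<close>, the index \<open>q\<close> is also
    at least \<open>N\<close>, so the Cauchy bounds apply.\<close>
  define q where "q = r (max N K)"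
  have "q \<ge> N"
    using strict_mono_imp_increasing[OF assms(5), of "max N K"] by (simp add: q_def)
  have "\<bar>p (f n x) (g x) - p (g x) (g x)\<bar> < \<epsilon> \<and> \<bar>p (f n x) (f n x) - p (g x) (g x)\<bar> < \<epsilon>"
    if "n \<ge> N" "x \<in> D" for n x
  proof -
    have X: "f n x \<in> X" "f q x \<in> X" "g x \<in> X"
      using assms(3,6) \<open>x \<in> D\<close> by auto
    have sub: "\<bar>p (f q x) (g x) - p (g x) (g x)\<bar> < \<epsilon> / 2"
        "\<bar>p (f q x) (f q x) - p (g x) (g x)\<bar> < \<epsilon> / 2"
      using K[of "max N K" x] \<open>x \<in> D\<close> by (simp_all add: q_def)
    \<comment> \<open>The index pairs \<open>(n, q)\<close> and \<open>(n, n)\<close> are each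
      compared with \<open>(q, q)\<close>; \<open>n\<close> may be smaller than \<open>q\<close>,
      hence the order-free form of \<open>N\<close>.\<close>
    have cau: "\<bar>p (f n x) (f q x) - p (f q x) (f q x)\<bar> < \<epsilon> / 2"
        "\<bar>p (f n x) (f n x) - p (f q x) (f q x)\<bar> < \<epsilon> / 2"
      using N \<open>n \<ge> N\<close> \<open>q \<ge> N\<close> \<open>x \<in> D\<close> by blast+
    \<comment> \<open>The mixed difference is nonnegative, so only an upper bound remains to be
      found.\<close>
    have "p (g x) (g x) \<le> p (f n x) (g x)"
      using self_le[of "g x" "f n x"] commute[of "g x" "f n x"] X by simp
    moreover have "p (f n x) (g x) \<le> p (f n x) (f q x) + p (f q x) (g x) - p (f q x) (f q x)"
      using triangle X by blast
    ultimately show ?thesis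
      using sub cau by linarith
  qed
  then show "\<exists>k. \<forall>n\<ge>k. \<forall>x\<in>D. \<bar>p (f n x) (g x) - p (g x) (g x)\<bar> < \<epsilon>
      \<and> \<bar>p (f n x) (f n x) - p (g x) (g x)\<bar> < \<epsilon>"
    by blast
qed

end
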